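(* Let $F : \mathbb{R} \to \mathbb{R}$ be a function. Then $F$, applied entrywise, maps $\mathcal{M}([-1,1])$ into itself if and only if $F$ is the restriction to $\mathbb{R}$ of an absolutely monotonic entire function.
   Context: An admissible measure is a non-negative measure $\mu$ on $\mathbb{R}$ possessing moments of all orders; its moments are $s_k(\mu) := \int_{\mathbb{R}} x^k \, d\mu$ ($k \geq 0$), where $s_0(\mu)$ is the total mass, and its moment sequence is $\mathbf{s}(\mu) := (s_k(\mu))_{k \geq 0}$. For $K \subset \mathbb{R}$, $\mathcal{M}(K)$ denotes the set of moment sequences $\mathbf{s}(\mu)$ of admissible measures $\mu$ supported on $K$. A function $F$ acts entrywise on a sequence by $F[(s_k)_{k\geq 0}] := (F(s_k))_{k \geq 0}$. An absolutely monotonic entire function is an entire function all of whose Taylor coefficients at $0$ are non-negative. *)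

theory Defs
  imports "HOL-Probability.Probability" "HOL-Complex_Analysis.Complex_Analysis"
begin

text \<open>The case \<open>k = 0\<close> of the integrability condition forces the total mass to be finite.\<close>

definition admissible :: "real measure \<Rightarrow> bool" where
  "admissible \<mu> \<longleftrightarrow> sets \<mu> = sets borel \<and> (\<forall>k::nat. integrable \<mu> (\<lambda>x. x ^ k))"

definition moment :: "real measure \<Rightarrow> nat \<Rightarrow> real" where
  "moment \<mu> k = (\<integral>x. x ^ k \<partial>\<mu>)"

text \<open>``Supported on \<open>K\<close>'' means that the complement of \<open>K\<close> is \<open>\<mu>\<close>-null; for closed \<open>K\<close>
  this says that the topological support of \<open>\<mu>\<close> is contained in \<open>K\<close>.\<close>

definition moment_sequences :: "real set \<Rightarrow> (nat \<Rightarrow> real) set" where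
  "moment_sequences K = {moment \<mu> | \<mu>. admissible \<mu> \<and> (AE x in \<mu>. x \<in> K)}"

definition entrywise :: "(real \<Rightarrow> real) \<Rightarrow> (nat \<Rightarrow> real) \<Rightarrow> (nat \<Rightarrow> real)" where
  "entrywise F s = (\<lambda>k. F (s k))"

definition absolutely_monotonic_entire :: "(complex \<Rightarrow> complex) \<Rightarrow> bool" where
  "absolutely_monotonic_entire f \<longleftrightarrow>
     f holomorphic_on UNIV \<and> (\<forall>n. (deriv ^^ n) f 0 / fact n \<in> \<real>\<^sub>\<ge>\<^sub>0)"

end

theory Submission imports Defs begin

text \<open>
If \<open>F(x) = \<Sum>n. c n * x ^ n\<close> with \<open>c n \<ge> 0\<close>, then \<open>F\<close> sends the moments of \<open>\<mu>\<close> to the moments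
of \<open>\<Sum>n. c n * \<mu>\<^sub>n\<close>, where \<open>\<mu>\<^sub>n\<close> is the \<open>n\<close>-fold multiplicative convolution of \<open>\<mu>\<close>: integrating
\<open>(x\<^sub>1 * \<dots> * x\<^sub>n) ^ k\<close> against a product measure gives the \<open>n\<close>-th power of the \<open>k\<close>-th moment, and
\<open>[-1, 1]\<close> is closed under products
(\<open>nonneg_power_series_preserves_moment_sequences\<close>).

For the converse only the measures \<open>a * \<delta>\<^sub>1 + b * \<delta>\<^sub>u\<close> are needed, whose moments are \<open>a + b * u ^ k\<close>.
A polynomial that is non-negative on \<open>[-1, 1]\<close> has a non-negative integral against the
measure with moments \<open>F (a + b * u ^ k)\<close>, so each such polynomial gives an inequality between
values of \<open>F\<close>.

On the positive half-line, the polynomials \<open>(1 - y\<^sup>2) ^ n\<close> with \<open>a = 0\<close> show that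
\<open>t \<mapsto> F (x * exp t)\<close> has non-negative differences of every order. The first two orders make it
continuous. All of them together make its Bernstein polynomials have non-negative coefficients,
hence bounded on the complex unit disc by their value at \<open>1\<close>, and a normal family argument
yields a holomorphic extension (\<open>nonneg_differences_imp_holomorphic_extension\<close>). So \<open>F\<close> is smooth
on the positive half-line. Next, with \<open>u = 1/2\<close> and \<open>b = 1\<close>, a non-negative polynomial that
vanishes at \<open>u ^ m\<close> for all \<open>m < n\<close> annihilates the Taylor terms of \<open>F (a + u ^ k)\<close> of order less
than \<open>n\<close>. As \<open>k\<close> grows, what is left is a positive multiple of the \<open>n\<close>-th derivative of \<open>F\<close> at \<open>a\<close>,
which is therefore non-negative (\<open>higher_deriv_nonneg_pos\<close>). Bernstein's remainder argument
then shows that \<open>F\<close> agrees on the positive half-line with an absolutely monotonic entire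
function \<open>g\<close> (\<open>entire_extension_pos\<close>).

Finally let \<open>x \<le> 0\<close>, and choose \<open>b \<ge> 0\<close> such that the moments \<open>s k = 1 + b * (-1/2) ^ k\<close> satisfy
\<open>s 1 = x\<close>. They are eventually positive, so \<open>F (s k) = g (s k)\<close> for all large \<open>k\<close>. Both are moment
sequences on \<open>[-1, 1]\<close>, the second by the first half of the theorem. Two moment sequences on
\<open>[-1, 1]\<close> that agree eventually agree at every positive index
(\<open>moment_sequences_eq_if_eventually_eq\<close>), and index \<open>1\<close> gives \<open>F x = g x\<close>.
\<close>

section \<open>Moment sequences on \<open>[-1, 1]\<close>\<close>

lemma integrable_on_unit_interval:
  fixes g :: "real \<Rightarrow> real"
  assumes "finite_measure \<mu>" "sets \<mu> = sets borel" "AE x in \<mu>. x \<in> {-1..1}"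
    and "g \<in> borel_measurable borel" "\<And>x. x \<in> {-1..1} \<Longrightarrow> \<bar>g x\<bar> \<le> B"
  shows "integrable \<mu> g"
proof (rule finite_measure.integrable_const_bound[OF assms(1)])
  show "AE x in \<mu>. norm (g x) \<le> B"
    using assms(3) by eventually_elim (use assms(5) in auto)
  show "g \<in> borel_measurable \<mu>"
    using assms(4) measurable_cong_sets[OF assms(2) refl] by blast
qed

lemma integrable_power_unit_interval:
  assumes "finite_measure \<mu>" "sets \<mu> = sets borel" "AE x in \<mu>. x \<in> {-1..1}"
  shows "integrable \<mu> (\<lambda>x::real. x ^ k)"
  by (rule integrable_on_unit_interval[OF assms, where B = 1])
     (auto simp: power_abs intro!: power_le_one)

lemma moment_sequences_unit_interval_iff:
  "s \<in> moment_sequences {-1..1} \<longleftrightarrow>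
    (\<exists>\<mu>. finite_measure \<mu> \<and> sets \<mu> = sets borel \<and> (AE x in \<mu>. x \<in> {-1..1}) \<and>
      (\<forall>k. s k = (\<integral>x. x ^ k \<partial>\<mu>)))" (is "?L \<longleftrightarrow> ?R")
proof
  assume ?L
  then obtain \<mu> where \<mu>: "s = moment \<mu>" "admissible \<mu>" "AE x in \<mu>. x \<in> {-1..1}"
    by (auto simp: moment_sequences_def)
  have "integrable \<mu> (\<lambda>x. x ^ 0)"
    using \<mu>(2) unfolding admissible_def by blast
  then have "integrable \<mu> (\<lambda>x. 1::real)" by simp
  then have "finite_measure \<mu>"
    by (auto simp: integrable_iff_bounded intro!: finite_measureI)
  then show ?R
    using \<mu> by (auto simp: admissible_def moment_def)
next
  assume ?R
  then obtain \<mu> where \<mu>: "finite_measure \<mu>" "sets \<mu> = sets borel" "AE x in \<mu>. x \<in> {-1..1}"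
    "\<And>k. s k = (\<integral>x. x ^ k \<partial>\<mu>)" by blast
  have "integrable \<mu> (\<lambda>x. x ^ k)" for k :: nat
    by (rule integrable_power_unit_interval[OF \<mu>(1-3)])
  moreover have "s = moment \<mu>"
    using \<mu>(4) by (auto simp: moment_def)
  ultimately show ?L
    using \<mu>(2,3) by (auto simp: moment_sequences_def admissible_def)
qed

text \<open>Every inequality between values of a transform of moment sequences comes from this
one. The exponents are an arbitrary family, so that sparse polynomials such as
\<open>(1 - y\<^sup>2) ^ n\<close> can be used in the form in which they are expanded.\<close>

lemma moment_sequence_test_nonneg:
  assumes "s \<in> moment_sequences {-1..1}" "finite I"
    and "\<And>x::real. x \<in> {-1..1} \<Longrightarrow> 0 \<le> (\<Sum>i\<in>I. c i * x ^ e i)"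
  shows "0 \<le> (\<Sum>i\<in>I. c i * s (e i))"
proof -
  obtain \<mu> where \<mu>: "finite_measure \<mu>" "sets \<mu> = sets borel" "AE x in \<mu>. x \<in> {-1..1}"
    "\<And>k. s k = (\<integral>x. x ^ k \<partial>\<mu>)"
    using assms(1) unfolding moment_sequences_unit_interval_iff by blast
  have int: "integrable \<mu> (\<lambda>x. x ^ k)" for k :: nat
    by (rule integrable_power_unit_interval[OF \<mu>(1-3)])
  have "0 \<le> (\<integral>x. (\<Sum>i\<in>I. c i * x ^ e i) \<partial>\<mu>)"
    by (rule integral_nonneg_AE) (use \<mu>(3) assms(3) in \<open>auto elim: eventually_mono\<close>)
  also have "\<dots> = (\<Sum>i\<in>I. c i * s (e i))"
    using int by (simp add: \<mu>(4))
  finally show ?thesis .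
qed

text \<open>These are the moments of \<open>a * \<delta>\<^sub>1 + b * \<delta>\<^sub>u\<close>, realised as the image of a
weighted two-point space.\<close>

lemma two_atom_moment_sequence:
  assumes "0 \<le> a" "0 \<le> b" "u \<in> {-1..1}"
  shows "(\<lambda>k. a + b * u ^ k) \<in> moment_sequences {-1..1}"
proof -
  let ?P = "point_measure UNIV (\<lambda>t. ennreal (if t then a else b))"
  let ?h = "\<lambda>t::bool. if t then 1 else u"
  define \<mu> where "\<mu> = distr ?P borel ?h"
  have m: "?h \<in> measurable ?P borel"
    by (simp add: measurable_def space_point_measure sets_point_measure)
  have "finite_measure ?P"
    by (rule finite_measureI) (simp add: space_point_measure emeasure_point_measure_finite)
  then have "finite_measure \<mu>"
    unfolding \<mu>_def by (rule finite_measure.finite_measure_distr) (rule m)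
  moreover have "AE x in \<mu>. x \<in> {-1..1}"
    unfolding \<mu>_def by (subst AE_distr_iff[OF m]) (use assms in \<open>auto intro!: always_eventually\<close>)
  moreover have "(\<integral>x. x ^ k \<partial>\<mu>) = a + b * u ^ k" for k :: nat
    unfolding \<mu>_def using assms
    by (subst integral_distr[OF m])
       (auto simp: lebesgue_integral_point_measure_finite UNIV_bool)
  ultimately show ?thesis
    unfolding moment_sequences_unit_interval_iff by (intro exI[of _ \<mu>]) (auto simp: \<mu>_def)
qed

lemma even_gap_test_pow_tendsto_0:
  fixes x :: real
  assumes "x \<in> {-1..1}" "0 < k"
  shows "(\<lambda>N. x ^ k * (1 - x\<^sup>2) ^ N) \<longlonglongrightarrow> 0"
proof (cases "x = 0")
  case False
  then have "0 \<le> 1 - x\<^sup>2" "1 - x\<^sup>2 < 1"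
    using assms by (auto simp: power_le_one_iff abs_square_le_1 abs_le_iff)
  then show ?thesis
    by (intro tendsto_mult_right_zero LIMSEQ_power_zero) auto
qed (use assms in auto)

lemma one_minus_square_power_expand:
  "(1 - x\<^sup>2) ^ N = (\<Sum>i\<le>N. of_nat (N choose i) * (-1) ^ i * (x::real) ^ (2 * i))"
proof -
  have "(1 - x\<^sup>2) ^ N = (- x\<^sup>2 + 1) ^ N" by simp
  also have "\<dots> = (\<Sum>i\<le>N. of_nat (N choose i) * (- x\<^sup>2) ^ i)"
    by (subst binomial_ring) simp
  also have "\<dots> = (\<Sum>i\<le>N. of_nat (N choose i) * (-1) ^ i * x ^ (2 * i))"
    by (intro sum.cong refl) (simp add: power_minus[of "x\<^sup>2"] power_mult)
  finally show ?thesis .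
qed

text \<open>A discrepancy at the last index \<open>k\<close> where the sequences differ would equal
the difference of the two integrals of \<open>x ^ k * (1 - x\<^sup>2) ^ N\<close>, for every \<open>N\<close>, because the other terms
of the expansion only involve later moments. These integrands tend to \<open>0\<close> on \<open>[-1, 1]\<close>:
the factor \<open>x ^ k\<close> takes care of \<open>x = 0\<close>. Index \<open>0\<close> has to be excluded, since a mass at \<open>0\<close> only
affects the total mass.\<close>

lemma moment_sequences_eq_if_eventually_eq:
  assumes "s \<in> moment_sequences {-1..1}" "t \<in> moment_sequences {-1..1}"
    and "\<And>k. K \<le> k \<Longrightarrow> s k = t k"
    and "0 < k"
  shows "s k = t k"
proof -
  obtain \<mu> where \<mu>: "finite_measure \<mu>" "sets \<mu> = sets borel" "AE x in \<mu>. x \<in> {-1..1}"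
    "\<And>k. s k = (\<integral>x. x ^ k \<partial>\<mu>)"
    using assms(1) unfolding moment_sequences_unit_interval_iff by blast
  obtain \<nu> where \<nu>: "finite_measure \<nu>" "sets \<nu> = sets borel" "AE x in \<nu>. x \<in> {-1..1}"
    "\<And>k. t k = (\<integral>x. x ^ k \<partial>\<nu>)"
    using assms(2) unfolding moment_sequences_unit_interval_iff by blast
  have lim: "(\<lambda>N. \<integral>x. x ^ k * (1 - x\<^sup>2) ^ N \<partial>M) \<longlonglongrightarrow> 0"
    if M: "finite_measure M" "sets M = sets borel" "AE x in M. x \<in> {-1..1}" and "0 < k"
    for M :: "real measure" and k :: nat
  proof -
    have [measurable]: "(\<lambda>x. x ^ k * (1 - x\<^sup>2) ^ N) \<in> borel_measurable M" for N :: nat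
      by (subst measurable_cong_sets[OF M(2) refl]) measurable
    have "(\<lambda>N. \<integral>x. x ^ k * (1 - x\<^sup>2) ^ N \<partial>M) \<longlonglongrightarrow> (\<integral>x. 0 \<partial>M)"
    proof (rule integral_dominated_convergence[where w = "\<lambda>x. 1"])
      show "integrable M (\<lambda>x. 1::real)"
        using M(1) by (simp add: finite_measure.integrable_const)
      show "AE x in M. (\<lambda>N. x ^ k * (1 - x\<^sup>2) ^ N) \<longlonglongrightarrow> 0"
        using M(3) by eventually_elim (rule even_gap_test_pow_tendsto_0[OF _ that(4)])
      show "AE x in M. norm (x ^ k * (1 - x\<^sup>2) ^ N) \<le> 1" for N
        using M(3)
      proof eventually_elim
        case (elim x)
        then have "\<bar>x\<bar> \<le> 1" "\<bar>1 - x\<^sup>2\<bar> \<le> 1"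
          using abs_square_le_1[of x] by auto
        then show ?case
          by (simp add: abs_mult power_abs mult_le_one power_le_one)
      qed
    qed auto
    then show ?thesis by simp
  qed
  have expand: "(\<integral>x. x ^ k * (1 - x\<^sup>2) ^ N \<partial>M) =
      (\<Sum>i\<le>N. of_nat (N choose i) * (-1) ^ i * (\<integral>x. x ^ (k + 2 * i) \<partial>M))"
    if M: "finite_measure M" "sets M = sets borel" "AE x in M. x \<in> {-1..1}"
    for M :: "real measure" and k N :: nat
  proof -
    have int: "integrable M (\<lambda>x. x ^ j)" for j :: nat
      by (rule integrable_power_unit_interval[OF M])
    have "x ^ k * (1 - x\<^sup>2) ^ N = (\<Sum>i\<le>N. of_nat (N choose i) * (-1) ^ i * x ^ (k + 2 * i))"
      for x :: real
      by (simp add: one_minus_square_power_expand sum_distrib_left power_add mult_ac)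
    then show ?thesis using int by simp
  qed
  have down: "s k = t k" if "0 < k" "\<And>j. k < j \<Longrightarrow> s j = t j" for k
  proof -
    have "(\<lambda>N. (\<integral>x. x ^ k * (1 - x\<^sup>2) ^ N \<partial>\<mu>) - (\<integral>x. x ^ k * (1 - x\<^sup>2) ^ N \<partial>\<nu>))
        \<longlonglongrightarrow> 0 - 0"
      by (intro tendsto_diff lim \<mu> \<nu> that)
    moreover have "(\<integral>x. x ^ k * (1 - x\<^sup>2) ^ N \<partial>\<mu>) - (\<integral>x. x ^ k * (1 - x\<^sup>2) ^ N \<partial>\<nu>) = s k - t k"
      for N
    proof -
      have "(\<integral>x. x ^ k * (1 - x\<^sup>2) ^ N \<partial>\<mu>) - (\<integral>x. x ^ k * (1 - x\<^sup>2) ^ N \<partial>\<nu>) =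
          (\<Sum>i\<le>N. of_nat (N choose i) * (-1) ^ i * (s (k + 2 * i) - t (k + 2 * i)))"
        unfolding expand[OF \<mu>(1-3)] expand[OF \<nu>(1-3)] \<mu>(4) \<nu>(4)
        by (simp add: sum_subtractf right_diff_distrib)
      also have "\<dots> = (\<Sum>i\<in>{0}. of_nat (N choose i) * (-1) ^ i * (s (k + 2 * i) - t (k + 2 * i)))"
        by (rule sum.mono_neutral_right) (use that(2) in auto)
      finally show ?thesis by simp
    qed
    ultimately have "(\<lambda>N::nat. s k - t k) \<longlonglongrightarrow> 0" by simp
    then show ?thesis by (simp add: LIMSEQ_const_iff)
  qed
  show ?thesis
    using \<open>0 < k\<close>
  proof (induction "K - k" arbitrary: k rule: less_induct)
    case less
    show ?case
    proof (cases "K \<le> k")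
      case False
      show ?thesis
        by (rule down[OF less.prems]) (use less False in auto)
    qed (use assms(3) in auto)
  qed
qed

section \<open>Power series with non-negative coefficients act on moment sequences\<close>

text \<open>The \<open>n\<close>-fold multiplicative convolution of a probability measure, that is, the law
of the product of \<open>n\<close> independent variables.\<close>

lemma multiplicative_power_measure:
  assumes P: "prob_space P" "sets P = sets borel" "AE x in P. x \<in> {-1..1}"
  defines "Q \<equiv> \<lambda>n. distr (PiM {..<n} (\<lambda>_::nat. P)) borel (\<lambda>\<omega>. \<Prod>i<n. \<omega> i :: real)"
  shows "prob_space (Q n)" "AE x in Q n. x \<in> {-1..1}"
    and "(\<integral>x. x ^ k \<partial>Q n) = (\<integral>x. x ^ k \<partial>P) ^ n"
proof -
  let ?\<Omega> = "PiM {..<n} (\<lambda>_::nat. P)"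
  have m: "(\<lambda>\<omega>. \<Prod>i<n. \<omega> i) \<in> borel_measurable ?\<Omega>"
  proof (rule borel_measurable_prod)
    fix i assume "i \<in> {..<n}"
    then have "(\<lambda>\<omega>. \<omega> i) \<in> measurable ?\<Omega> P" by measurable
    then show "(\<lambda>\<omega>. \<omega> i) \<in> borel_measurable ?\<Omega>"
      using measurable_cong_sets[OF refl P(2)] by blast
  qed
  interpret P: prob_space P by fact
  have \<Omega>: "prob_space ?\<Omega>"
    by (rule prob_space_PiM) (rule P(1))
  show "prob_space (Q n)"
    unfolding Q_def by (rule prob_space.prob_space_distr[OF \<Omega> m])
  have "AE \<omega> in ?\<Omega>. \<forall>i\<in>{..<n}. \<omega> i \<in> {-1..1}"
    by (intro eventually_ball_finite ballI AE_PiM_component[of _ "\<lambda>_. P"] P) auto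
  then have "AE \<omega> in ?\<Omega>. (\<Prod>i<n. \<omega> i) \<in> {-1..1}"
  proof eventually_elim
    case (elim \<omega>)
    then have "\<bar>\<Prod>i<n. \<omega> i\<bar> \<le> 1"
      unfolding abs_prod by (intro prod_le_1) (auto simp: abs_le_iff)
    then show ?case by (auto simp: abs_le_iff)
  qed
  then show "AE x in Q n. x \<in> {-1..1}"
    unfolding Q_def by (subst AE_distr_iff[OF m]) auto
  interpret product_sigma_finite "\<lambda>_::nat. P" by standard
  have int: "integrable P (\<lambda>x. x ^ k)"
    by (rule integrable_power_unit_interval[OF P.finite_measure_axioms P(2,3)])
  have "(\<integral>x. x ^ k \<partial>Q n) = (\<integral>\<omega>. (\<Prod>i<n. \<omega> i ^ k) \<partial>?\<Omega>)"
    unfolding Q_def by (subst integral_distr[OF m]) (auto simp: prod_power_distrib)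
  also have "\<dots> = (\<integral>x. x ^ k \<partial>P) ^ n"
    by (subst product_integral_prod) (auto intro: int)
  finally show "(\<integral>x. x ^ k \<partial>Q n) = (\<integral>x. x ^ k \<partial>P) ^ n" .
qed

lemma normalized_measure:
  fixes f :: "'a \<Rightarrow> real"
  assumes "finite_measure \<mu>" "0 < measure \<mu> (space \<mu>)"
  defines "P \<equiv> density \<mu> (\<lambda>_. ennreal (1 / measure \<mu> (space \<mu>)))"
  shows "prob_space P" "AE x in \<mu>. R x \<Longrightarrow> AE x in P. R x"
    and "f \<in> borel_measurable \<mu> \<Longrightarrow>
      (\<integral>x. f x \<partial>P) = (\<integral>x. f x \<partial>\<mu>) / measure \<mu> (space \<mu>)"
proof -
  interpret finite_measure \<mu> by fact
  show "prob_space P"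
    using assms(2)
    by (intro prob_spaceI)
       (simp add: P_def emeasure_density emeasure_eq_measure flip: ennreal_mult)
  show "AE x in P. R x" if "AE x in \<mu>. R x"
    unfolding P_def using that by (subst AE_density) auto
  show "(\<integral>x. f x \<partial>P) = (\<integral>x. f x \<partial>\<mu>) / measure \<mu> (space \<mu>)"
    if "f \<in> borel_measurable \<mu>"
    unfolding P_def using that by (subst integral_density) auto
qed

text \<open>The mixture \<open>\<Sum>n. w n * Q n\<close> is formed as a monadic bind of the weights,
seen as a finite measure on the natural numbers, with the kernel \<open>Q\<close>.\<close>

lemma measure_mixture:
  fixes Q :: "nat \<Rightarrow> real measure" and w :: "nat \<Rightarrow> real"
  assumes w: "\<And>n. 0 \<le> w n" "summable w"
    and Q: "\<And>n. prob_space (Q n)" "\<And>n. sets (Q n) = sets borel" "\<And>n. AE x in Q n. x \<in> {-1..1}"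
  shows "(\<lambda>k. \<Sum>n. w n * (\<integral>x. x ^ k \<partial>Q n)) \<in> moment_sequences {-1..1}"
proof -
  define W where "W = density (count_space UNIV) (\<lambda>n. ennreal (w n))"
  have W: "space W = UNIV" "sets W = UNIV"
    by (auto simp: W_def)
  have "emeasure W UNIV = (\<Sum>n. ennreal (w n))"
    by (simp add: W_def emeasure_density nn_integral_count_space_nat)
  then have emW: "emeasure W UNIV = ennreal (\<Sum>n. w n)"
    using w by (simp add: suminf_ennreal2)
  then have fin: "finite_measure W"
    by (intro finite_measureI) (simp add: W)
  have Qm: "Q \<in> measurable W (subprob_algebra borel)"
    using Q by (auto simp: measurable_def W space_subprob_algebra prob_space_imp_subprob_space)
  define \<nu> where "\<nu> = W \<bind> Q"
  have sets_\<nu>: "sets \<nu> = sets borel"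
    unfolding \<nu>_def by (rule sets_bind) (auto simp: Q W)
  then have space_\<nu>: "space \<nu> = UNIV"
    using sets_eq_imp_space_eq by force
  have "emeasure \<nu> UNIV = (\<integral>\<^sup>+n. emeasure (Q n) UNIV \<partial>W)"
    unfolding \<nu>_def by (rule emeasure_bind[OF _ Qm]) (auto simp: W)
  also have "\<dots> = (\<integral>\<^sup>+n. 1 \<partial>W)"
  proof (rule nn_integral_cong)
    fix n
    have "space (Q n) = UNIV" using sets_eq_imp_space_eq[OF Q(2)] by simp
    then show "emeasure (Q n) UNIV = 1"
      using prob_space.emeasure_space_1[OF Q(1)] by metis
  qed
  finally have fin_\<nu>: "finite_measure \<nu>"
    by (intro finite_measureI) (simp add: space_\<nu> W emW)
  have AE_\<nu>: "AE x in \<nu>. x \<in> {-1..1}"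
    unfolding \<nu>_def by (subst AE_bind[OF Qm]) (auto simp: Q(3)[simplified])
  have "(\<integral>x. x ^ k \<partial>\<nu>) = (\<Sum>n. w n * (\<integral>x. x ^ k \<partial>Q n))" for k :: nat
  proof -
    \<comment> \<open>Clipping makes the monomial bounded on the whole line.\<close>
    define g :: "real \<Rightarrow> real" where "g = (\<lambda>x. (max (-1) (min 1 x)) ^ k)"
    have [measurable]: "g \<in> borel_measurable borel" by (simp add: g_def)
    have g_le: "\<bar>g x\<bar> \<le> 1" for x
      unfolding g_def power_abs by (intro power_le_one) auto
    have g_eq: "(\<integral>x. x ^ k \<partial>M) = (\<integral>x. g x \<partial>M)"
      if "sets M = sets borel" "AE x in M. x \<in> {-1..1}" for M :: "real measure"
    proof (rule integral_cong_AE)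
      show "AE x in M. x ^ k = g x"
        using that(2) by eventually_elim (auto simp: g_def)
    qed (subst measurable_cong_sets[OF that(1) refl], measurable)+
    have Qk_le: "\<bar>\<integral>x. g x \<partial>Q n\<bar> \<le> 1" for n
    proof -
      have "\<bar>\<integral>x. g x \<partial>Q n\<bar> \<le> (\<integral>x. \<bar>g x\<bar> \<partial>Q n)" by (rule integral_abs_bound)
      also have "\<dots> \<le> 1"
        by (rule prob_space.integral_le_const[OF Q(1)])
           (auto simp: g_le intro!: finite_measure.integrable_const_bound[where B = 1] prob_space.finite_measure Q
              simp: measurable_cong_sets[OF Q(2) refl])
      finally show ?thesis .
    qed
    have "(\<integral>x. x ^ k \<partial>\<nu>) = (\<integral>x. g x \<partial>\<nu>)"
      by (rule g_eq[OF sets_\<nu> AE_\<nu>])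
    also have "\<dots> = (\<integral>n. (\<integral>x. g x \<partial>Q n) \<partial>W)"
      unfolding \<nu>_def
    proof (rule integral_bind[where K = borel and B = 1 and B' = 1])
      show "AE n in W. emeasure (Q n) (space (Q n)) \<le> ennreal 1"
        using prob_space.emeasure_space_1[OF Q(1)] by auto
    qed (use g_le Qm fin in auto)
    also have "\<dots> = (\<integral>n. w n * (\<integral>x. g x \<partial>Q n) \<partial>count_space UNIV)"
      unfolding W_def by (subst integral_density) (auto simp: w)
    also have "\<dots> = (\<Sum>n. w n * (\<integral>x. g x \<partial>Q n))"
    proof (rule integral_count_space_nat, unfold integrable_count_space_nat_iff)
      show "summable (\<lambda>n. norm (w n * (\<integral>x. g x \<partial>Q n)))"
        by (rule summable_comparison_test'[OF w(2)])
           (simp add: abs_mult w mult_left_le Qk_le)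
    qed
    also have "\<dots> = (\<Sum>n. w n * (\<integral>x. x ^ k \<partial>Q n))"
      by (simp only: g_eq[OF Q(2,3)])
    finally show ?thesis .
  qed
  then show ?thesis
    unfolding moment_sequences_unit_interval_iff
    using fin_\<nu> sets_\<nu> AE_\<nu> by (intro exI[of _ \<nu>]) auto
qed

text \<open>A measure of mass \<open>m > 0\<close> is normalised before convolving, and the powers of
\<open>m\<close> are absorbed into the weights \<open>c n * m ^ n\<close>. The zero measure has the moment sequence
\<open>0\<close>, which is sent to the constant sequence \<open>c 0\<close>, the moments of \<open>c 0 * \<delta>\<^sub>1\<close>.\<close>

lemma nonneg_power_series_preserves_moment_sequences:
  assumes c: "\<And>n. 0 \<le> c n" "\<And>x. (\<lambda>n. c n * x ^ n) sums G x"
    and s: "s \<in> moment_sequences {-1..1}"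
  shows "entrywise G s \<in> moment_sequences {-1..1}"
proof -
  obtain \<mu> where \<mu>: "finite_measure \<mu>" "sets \<mu> = sets borel" "AE x in \<mu>. x \<in> {-1..1}"
    "\<And>k. s k = (\<integral>x. x ^ k \<partial>\<mu>)"
    using s unfolding moment_sequences_unit_interval_iff by blast
  define m where "m = measure \<mu> (space \<mu>)"
  show ?thesis
  proof (cases "m = 0")
    case True
    then have "AE x in \<mu>. False"
      using finite_measure.emeasure_eq_measure[OF \<mu>(1)]
      by (intro AE_I[where N = "space \<mu>"]) (auto simp: m_def)
    then have "s k = 0" for k
      unfolding \<mu>(4) by (intro integral_eq_zero_AE) (auto elim: eventually_mono)
    moreover have "G 0 = c 0"
      using sums_unique2[OF c(2)[of 0] sums_finite[of "{0}" "\<lambda>n. c n * 0 ^ n"]] by simp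
    ultimately have "entrywise G s = (\<lambda>k. c 0 + 0 * 0 ^ k)"
      by (auto simp: entrywise_def)
    then show ?thesis
      using two_atom_moment_sequence[of "c 0" 0 0] c(1) by simp
  next
    case False
    then have m: "0 < m" by (simp add: m_def zero_less_measure_iff)
    define P where "P = density \<mu> (\<lambda>_. ennreal (1 / m))"
    have P: "prob_space P" "sets P = sets borel" "AE x in P. x \<in> {-1..1}"
      unfolding P_def m_def
      using normalized_measure(1)[OF \<mu>(1) m[unfolded m_def]]
        normalized_measure(2)[OF \<mu>(1) m[unfolded m_def] \<mu>(3)] \<mu>(2) by simp_all
    have Pk: "(\<integral>x. x ^ k \<partial>P) = s k / m" for k :: nat
      using normalized_measure(3)[OF \<mu>(1) m[unfolded m_def], of "\<lambda>x. x ^ k"]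
      by (simp add: P_def m_def \<mu>(4) measurable_cong_sets[OF \<mu>(2) refl])
    define Q where "Q = (\<lambda>n. distr (PiM {..<n} (\<lambda>_::nat. P)) borel (\<lambda>\<omega>. \<Prod>i<n. \<omega> i :: real))"
    have "(\<lambda>k. \<Sum>n. (c n * m ^ n) * (\<integral>x. x ^ k \<partial>Q n)) \<in> moment_sequences {-1..1}"
    proof (rule measure_mixture)
      show "0 \<le> c n * m ^ n" for n using c(1) m by simp
      show "summable (\<lambda>n. c n * m ^ n)" using c(2) sums_summable by blast
      show "prob_space (Q n)" for n
        unfolding Q_def by (rule multiplicative_power_measure(1)[OF P])
      show "AE x in Q n. x \<in> {-1..1}" for n
        unfolding Q_def by (rule multiplicative_power_measure(2)[OF P])
    qed (simp add: Q_def)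
    also have "(\<lambda>k. \<Sum>n. (c n * m ^ n) * (\<integral>x. x ^ k \<partial>Q n)) = entrywise G s"
    proof
      fix k
      have "(\<Sum>n. (c n * m ^ n) * (\<integral>x. x ^ k \<partial>Q n)) = (\<Sum>n. c n * s k ^ n)"
        using m by (simp add: Q_def multiplicative_power_measure(3)[OF P] Pk power_divide)
      then show "(\<Sum>n. (c n * m ^ n) * (\<integral>x. x ^ k \<partial>Q n)) = entrywise G s k"
        using sums_unique[OF c(2)[of "s k"]] by (simp add: entrywise_def)
    qed
    finally show ?thesis .
  qed
qed

section \<open>Analytic continuation from non-negative differences\<close>

text \<open>With the shift \<open>E\<close>, both sides expand \<open>((1 - x) + x * E) ^ N = (1 + x * (E - 1)) ^ N\<close>
applied to \<open>g\<close> at \<open>0\<close>.\<close>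

lemma Bernstein_sum_Newton_form:
  "(\<Sum>k\<le>N. g k * Bernstein N k x) =
    (\<Sum>n\<le>N. of_nat (N choose n) * (\<Sum>j\<le>n. (-1) ^ (n - j) * of_nat (n choose j) * g j) * x ^ n)"
proof -
  have inner: "(\<Sum>n\<le>N. of_nat (N choose n) * of_nat (n choose j) * (-1) ^ (n - j) * x ^ n) = Bernstein N j x"
    if "j \<le> N" for j
  proof -
    have "(\<Sum>n\<le>N. of_nat (N choose n) * of_nat (n choose j) * (-1) ^ (n - j) * x ^ n) =
        (\<Sum>n\<in>{j..N}. of_nat (N choose n) * of_nat (n choose j) * (-1) ^ (n - j) * x ^ n)"
      by (rule sum.mono_neutral_right) (auto simp: binomial_eq_0)
    also have "\<dots> = (\<Sum>i\<le>N - j. of_nat (N choose (i + j)) * of_nat ((i + j) choose j) * (-1) ^ i * x ^ (i + j))"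
      by (rule sum.reindex_bij_witness[of _ "\<lambda>i. i + j" "\<lambda>n. n - j"]) (use that in auto)
    also have "\<dots> = (\<Sum>i\<le>N - j. of_nat (N choose j) * x ^ j * (of_nat ((N - j) choose i) * (- x) ^ i))"
    proof (rule sum.cong[OF refl])
      fix i assume "i \<in> {..N - j}"
      then have "(N choose (i + j)) * ((i + j) choose j) = (N choose j) * ((N - j) choose i)"
        using choose_mult[of j "i + j" N] that by simp
      then have "real (N choose (i + j)) * real ((i + j) choose j) = real (N choose j) * real ((N - j) choose i)"
        by (metis of_nat_mult)
      then show "real (N choose (i + j)) * real ((i + j) choose j) * (-1) ^ i * x ^ (i + j) =
          real (N choose j) * x ^ j * (real ((N - j) choose i) * (- x) ^ i)"
        by (simp add: power_add power_minus[of x])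
    qed
    also have "\<dots> = of_nat (N choose j) * x ^ j * (- x + 1) ^ (N - j)"
      unfolding binomial_ring[of "- x" 1] by (simp add: sum_distrib_left)
    finally show ?thesis by (simp add: Bernstein_def)
  qed
  have "(\<Sum>n\<le>N. of_nat (N choose n) * (\<Sum>j\<le>n. (-1) ^ (n - j) * of_nat (n choose j) * g j) * x ^ n) =
      (\<Sum>n\<le>N. \<Sum>j\<le>N. g j * (of_nat (N choose n) * of_nat (n choose j) * (-1) ^ (n - j) * x ^ n))"
  proof (rule sum.cong[OF refl])
    fix n assume "n \<in> {..N}"
    then have "(\<Sum>j\<le>n. (-1) ^ (n - j) * of_nat (n choose j) * g j) =
        (\<Sum>j\<le>N. (-1) ^ (n - j) * of_nat (n choose j) * g j)"
      by (intro sum.mono_neutral_left) (auto simp: binomial_eq_0)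
    then show "of_nat (N choose n) * (\<Sum>j\<le>n. (-1) ^ (n - j) * of_nat (n choose j) * g j) * x ^ n =
      (\<Sum>j\<le>N. g j * (of_nat (N choose n) * of_nat (n choose j) * (-1) ^ (n - j) * x ^ n))"
      by (simp add: sum_distrib_left sum_distrib_right mult_ac)
  qed
  also have "\<dots> = (\<Sum>j\<le>N. \<Sum>n\<le>N. g j * (of_nat (N choose n) * of_nat (n choose j) * (-1) ^ (n - j) * x ^ n))"
    by (rule sum.swap)
  also have "\<dots> = (\<Sum>j\<le>N. g j * Bernstein N j x)"
    by (intro sum.cong refl) (simp add: inner flip: sum_distrib_left)
  finally show ?thesis by simp
qed

text \<open>By \<open>Bernstein_sum_Newton_form\<close> the Bernstein polynomials of \<open>f\<close> have non-negative
coefficients, so on the closed unit disc they are bounded by their common value \<open>f 1\<close> at \<open>1\<close>.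
Montel's theorem extracts a locally uniform limit, which agrees with \<open>f\<close> on the real segment by
Bernstein's proof of the Weierstrass theorem.\<close>

lemma nonneg_differences_imp_holomorphic_extension:
  fixes f :: "real \<Rightarrow> real"
  assumes cont: "continuous_on {0..1} f"
    and diff: "\<And>N n. n \<le> N \<Longrightarrow> 0 \<le> (\<Sum>j\<le>n. (-1) ^ (n - j) * of_nat (n choose j) * f (of_nat j / of_nat N))"
  obtains H where "H holomorphic_on ball 0 1"
    and "\<And>x. 0 \<le> x \<Longrightarrow> x < 1 \<Longrightarrow> H (complex_of_real x) = complex_of_real (f x)"
proof -
  define d where "d = (\<lambda>N n. of_nat (N choose n) *
    (\<Sum>j\<le>n. (-1) ^ (n - j) * of_nat (n choose j) * f (of_nat j / of_nat N)))"
  define P where "P = (\<lambda>N z. \<Sum>n\<le>N. complex_of_real (d N n) * z ^ n)"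
  have d: "0 \<le> d N n" if "n \<le> N" for N n
    using diff[OF that] by (simp add: d_def)
  have P_real: "P N (of_real x) = of_real (\<Sum>k\<le>N. f (of_nat k / of_nat N) * Bernstein N k x)" for N x
    unfolding P_def Bernstein_sum_Newton_form d_def by simp
  have P_1: "(\<Sum>n\<le>N. d N n) = f 1" if "0 < N" for N
  proof -
    have "(\<Sum>n\<le>N. d N n) = (\<Sum>k\<le>N. f (of_nat k / of_nat N) * Bernstein N k 1)"
      unfolding Bernstein_sum_Newton_form d_def by simp
    also have "\<dots> = (\<Sum>k\<in>{N}. f (of_nat k / of_nat N) * Bernstein N k 1)"
      by (rule sum.mono_neutral_right) (auto simp: Bernstein_def)
    finally show ?thesis using that by (simp add: Bernstein_def)
  qed
  have P_le: "norm (P (Suc N) z) \<le> f 1" if "norm z \<le> 1" for N z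
  proof -
    have "norm (P (Suc N) z) \<le> (\<Sum>n\<le>Suc N. norm (complex_of_real (d (Suc N) n) * z ^ n))"
      unfolding P_def by (rule norm_sum)
    also have "\<dots> \<le> (\<Sum>n\<le>Suc N. d (Suc N) n)"
      by (intro sum_mono) (auto simp: norm_mult norm_power d that power_le_one mult_left_le)
    finally show ?thesis by (simp only: P_1 zero_less_Suc)
  qed
  \<comment> \<open>For degree \<open>0\<close> the only node is \<open>0 / 0 = 0\<close>, so the bound by \<open>f 1\<close> starts at degree \<open>1\<close>.\<close>
  define \<F> where "\<F> = (\<lambda>N. P (Suc N))"
  obtain H r where H: "H holomorphic_on ball 0 1" "strict_mono (r :: nat \<Rightarrow> nat)"
    "\<And>x. x \<in> ball 0 1 \<Longrightarrow> (\<lambda>n. \<F> (r n) x) \<longlonglongrightarrow> H x"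
  proof (rule Montel[where \<F> = \<F> and \<H> = "range \<F>" and S = "ball 0 1"])
    show "h holomorphic_on ball 0 1" if "h \<in> range \<F>" for h
      using that by (auto simp: \<F>_def P_def intro!: holomorphic_intros)
    show "\<exists>B. \<forall>h\<in>range \<F>. \<forall>z\<in>K. norm (h z) \<le> B" if "compact K" "K \<subseteq> ball 0 1" for K
    proof (intro exI[of _ "f 1"] ballI)
      fix h z assume "h \<in> range \<F>" "z \<in> K"
      with that show "norm (h z) \<le> f 1"
        unfolding \<F>_def using P_le by (auto simp: subset_eq intro: less_imp_le)
    qed
  qed auto
  have "H (of_real x) = of_real (f x)" if x: "0 \<le> x" "x < 1" for x
  proof -
    have "(\<lambda>N. \<Sum>k\<le>N. f (of_nat k / of_nat N) * Bernstein N k x) \<longlonglongrightarrow> f x"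
    proof (rule LIMSEQ_I)
      fix e :: real assume "0 < e"
      from Bernstein_Weierstrass[OF cont this] obtain n0 where
        "\<And>n x. n0 \<le> n \<Longrightarrow> x \<in> {0..1} \<Longrightarrow>
          \<bar>f x - (\<Sum>k\<le>n. f (of_nat k / of_nat n) * Bernstein n k x)\<bar> < e"
        by blast
      then show "\<exists>n0. \<forall>n\<ge>n0. norm ((\<Sum>k\<le>n. f (of_nat k / of_nat n) * Bernstein n k x) - f x) < e"
        using x by (intro exI[of _ n0]) (auto simp: abs_minus_commute)
    qed
    then have "(\<lambda>N. P N (of_real x)) \<longlonglongrightarrow> of_real (f x)"
      unfolding P_real by (rule tendsto_of_real)
    then have "(\<lambda>N. P (Suc (r N)) (of_real x)) \<longlonglongrightarrow> of_real (f x)"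
      by (rule filterlim_compose) (intro filterlim_compose[OF filterlim_Suc] filterlim_subseq H)
    moreover have "(\<lambda>N. P (Suc (r N)) (of_real x)) \<longlonglongrightarrow> H (of_real x)"
      using H(3)[of "of_real x"] x by (simp add: \<F>_def)
    ultimately show ?thesis using LIMSEQ_unique by blast
  qed
  with H(1) show thesis by (rule that)
qed

text \<open>Midpoint convexity makes the increments over steps of a fixed length increasing, so
the increment over \<open>1/N\<close> is at most \<open>1/N\<close> times the increment over a unit step. Together with
monotonicity this bounds the oscillation near each point.\<close>

lemma midconvex_mono_imp_isCont:
  fixes g :: "real \<Rightarrow> real"
  assumes mono: "mono g" and nonneg: "\<And>t. 0 \<le> g t"
    and mid: "\<And>t h. 0 \<le> h \<Longrightarrow> 2 * g (t + h) \<le> g t + g (t + 2 * h)"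
  shows "isCont g t"
proof -
  have step: "g (t + h) - g t \<le> g (t + h + of_nat i * h) - g (t + of_nat i * h)"
    if "0 \<le> h" for t h and i :: nat
  proof (induction i)
    case (Suc i)
    then show ?case
      using mid[OF that, of "t + of_nat i * h"] by (simp add: algebra_simps)
  qed simp
  have small: "of_nat N * (g (t + 1 / of_nat N) - g t) \<le> g (t + 1)" if "0 < N" for t and N :: nat
  proof -
    let ?h = "1 / real N"
    have "of_nat N * (g (t + ?h) - g t) = (\<Sum>i<N. g (t + ?h) - g t)" by simp
    also have "\<dots> \<le> (\<Sum>i<N. g (t + of_nat (Suc i) * ?h) - g (t + of_nat i * ?h))"
      by (intro sum_mono) (use step[of ?h t] in \<open>simp add: algebra_simps add_divide_distrib\<close>)
    also have "\<dots> = g (t + of_nat N * ?h) - g (t + of_nat 0 * ?h)"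
      by (rule sum_lessThan_telescope)
    also have "\<dots> \<le> g (t + 1)" using that nonneg[of t] by simp
    finally show ?thesis .
  qed
  show ?thesis
    unfolding continuous_at_eps_delta
  proof (intro allI impI)
    fix e :: real assume "0 < e"
    then obtain N :: nat where N: "g (t + 1) / e < of_nat N" "0 < N"
      by (metis reals_Archimedean2 gr0I of_nat_0 nonneg divide_nonneg_pos not_less less_imp_le)
    have lt: "g (u + 1 / of_nat N) - g u < e" if "u \<le> t" for u
    proof -
      have "of_nat N * (g (u + 1 / of_nat N) - g u) \<le> g (t + 1)"
        using small[OF N(2), of u] monoD[OF mono, of "u + 1" "t + 1"] that by simp
      also have "\<dots> < of_nat N * e" using N \<open>0 < e\<close> by (simp add: field_simps)
      finally show ?thesis using N by simp
    qed
    show "\<exists>d>0. \<forall>u. dist u t < d \<longrightarrow> dist (g u) (g t) < e"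
    proof (intro exI[of _ "1 / of_nat N"] conjI allI impI)
      fix u assume u: "dist u t < 1 / of_nat N"
      show "dist (g u) (g t) < e"
      proof (cases "u \<le> t")
        case True
        then show ?thesis
          using lt[of u] monoD[OF mono, of u t] monoD[OF mono, of t "u + 1 / of_nat N"] u
          by (auto simp: dist_real_def)
      next
        case False
        then show ?thesis
          using lt[of t] monoD[OF mono, of t u] monoD[OF mono, of u "t + 1 / of_nat N"] u
          by (auto simp: dist_real_def)
      qed
    qed (use N in auto)
  qed
qed

text \<open>A holomorphic function that is real on a real interval has a real derivative there,
since the imaginary part is constant along the interval.\<close>

lemma deriv_real_of_holomorphic:
  assumes hol: "h holomorphic_on ball (complex_of_real a) r"
    and eq: "\<And>x. \<bar>x - a\<bar> < r \<Longrightarrow> h (of_real x) = of_real (F x)"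
    and x: "\<bar>x - a\<bar> < r"
  shows "(F has_real_derivative deriv F x) (at x)" "deriv h (of_real x) = of_real (deriv F x)"
proof -
  have inball: "of_real y \<in> ball (complex_of_real a) r \<longleftrightarrow> \<bar>y - a\<bar> < r" for y
    by (simp add: dist_norm abs_minus_commute flip: of_real_diff)
  have "(h has_field_derivative deriv h (of_real x)) (at (of_real x))"
    using hol x inball by (intro holomorphic_derivI[of h "ball (of_real a) r"]) auto
  then have "((\<lambda>x. h (of_real x)) has_vector_derivative deriv h (of_real x)) (at x)"
    by (rule has_vector_derivative_real_field)
  then have v: "((\<lambda>x. complex_of_real (F x)) has_vector_derivative deriv h (of_real x)) (at x)"
  proof (rule has_vector_derivative_transform_within_open)
    show "open {a - r<..<a + r}" by simp
  qed (use x eq in \<open>auto simp: abs_less_iff algebra_simps\<close>)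
  have re: "(F has_real_derivative Re (deriv h (of_real x))) (at x)"
    using bounded_linear.has_vector_derivative[OF bounded_linear_Re v]
    by (simp add: has_real_derivative_iff_has_vector_derivative)
  have "((\<lambda>_. 0::real) has_vector_derivative Im (deriv h (of_real x))) (at x)"
    using bounded_linear.has_vector_derivative[OF bounded_linear_Im v] by simp
  then have im: "Im (deriv h (of_real x)) = 0"
    by (metis has_vector_derivative_const vector_derivative_unique_at)
  have "deriv F x = Re (deriv h (of_real x))"
    using re by (rule DERIV_imp_deriv)
  then show "(F has_real_derivative deriv F x) (at x)" "deriv h (of_real x) = of_real (deriv F x)"
    using re im by (auto simp: complex_eq_iff)
qed

lemma higher_deriv_real_of_holomorphic:
  assumes hol: "h holomorphic_on ball (complex_of_real a) r"
    and eq: "\<And>x. \<bar>x - a\<bar> < r \<Longrightarrow> h (of_real x) = of_real (F x)"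
    and x: "\<bar>x - a\<bar> < r"
  shows "(deriv ^^ n) h (of_real x) = of_real ((deriv ^^ n) F x)"
    and "((deriv ^^ n) F has_real_derivative (deriv ^^ Suc n) F x) (at x)"
proof -
  have *: "(deriv ^^ n) h (of_real x) = of_real ((deriv ^^ n) F x)" if "\<bar>x - a\<bar> < r" for x
    using that
  proof (induction n arbitrary: x)
    case (Suc n)
    then show ?case
      using deriv_real_of_holomorphic(2)[OF holomorphic_higher_deriv[OF hol open_ball, of n] Suc.IH]
      by simp
  qed (use eq in auto)
  show "(deriv ^^ n) h (of_real x) = of_real ((deriv ^^ n) F x)"
    by (rule *[OF x])
  show "((deriv ^^ n) F has_real_derivative (deriv ^^ Suc n) F x) (at x)"
    using deriv_real_of_holomorphic(1)[OF holomorphic_higher_deriv[OF hol open_ball, of n] * x]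
    by simp
qed

section \<open>Transforms of moment sequences on the positive half-line\<close>

context
  fixes F :: "real \<Rightarrow> real"
  assumes preserves: "\<forall>s \<in> moment_sequences {-1..1}. entrywise F s \<in> moment_sequences {-1..1}"
begin

lemma two_atom_test_nonneg:
  assumes "0 \<le> a" "0 \<le> b" "u \<in> {-1..1}" "finite I"
    and "\<And>x::real. x \<in> {-1..1} \<Longrightarrow> 0 \<le> (\<Sum>i\<in>I. c i * x ^ e i)"
  shows "0 \<le> (\<Sum>i\<in>I. c i * F (a + b * u ^ e i))"
  using moment_sequence_test_nonneg[OF preserves[rule_format, OF two_atom_moment_sequence[OF assms(1-3)]] assms(4,5)]
  by (simp add: entrywise_def)

text \<open>The test polynomial is \<open>(1 - y\<^sup>2) ^ n\<close>. Its even exponents are what make it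
non-negative on the whole of \<open>[-1, 1]\<close>, hence the ratio \<open>u = exp (- h / 2)\<close>. The moments decrease
with the index, so the sum is reversed at the end.\<close>

lemma geometric_differences_nonneg:
  assumes "0 \<le> x" "0 \<le> h"
  shows "0 \<le> (\<Sum>j\<le>n. (-1) ^ (n - j) * of_nat (n choose j) * F (x * exp (of_nat j * h)))"
proof -
  have "0 \<le> (\<Sum>i\<le>n. (of_nat (n choose i) * (-1) ^ i) * F (0 + x * exp (of_nat n * h) * exp (- h / 2) ^ (2 * i)))"
  proof (rule two_atom_test_nonneg)
    fix y :: real assume "y \<in> {-1..1}"
    then have "0 \<le> (1 - y\<^sup>2) ^ n" by (simp add: abs_square_le_1 abs_le_iff)
    then show "0 \<le> (\<Sum>i\<le>n. (of_nat (n choose i) * (-1) ^ i) * y ^ (2 * i))"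
      by (simp add: one_minus_square_power_expand)
  qed (use assms in \<open>auto intro: order_trans[of _ 0]\<close>)
  also have "\<dots> = (\<Sum>i\<le>n. (-1) ^ i * of_nat (n choose i) * F (x * exp (of_nat (n - i) * h)))"
  proof (rule sum.cong[OF refl])
    fix i assume i: "i \<in> {..n}"
    have "exp (of_nat n * h) * exp (- h / 2) ^ (2 * i) = exp (of_nat n * h + of_nat (2 * i) * (- h / 2))"
      unfolding exp_add by (simp only: exp_of_nat_mult)
    also have "of_nat n * h + of_nat (2 * i) * (- h / 2) = of_nat (n - i) * h"
      using i by (simp add: of_nat_diff algebra_simps)
    finally show "(of_nat (n choose i) * (-1) ^ i) * F (0 + x * exp (of_nat n * h) * exp (- h / 2) ^ (2 * i)) =
        (-1) ^ i * of_nat (n choose i) * F (x * exp (of_nat (n - i) * h))"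
      by (simp add: mult.assoc)
  qed
  also have "\<dots> = (\<Sum>j\<le>n. (-1) ^ (n - j) * of_nat (n choose j) * F (x * exp (of_nat j * h)))"
    by (rule sum.reindex_bij_witness[of _ "\<lambda>j. n - j" "\<lambda>j. n - j"]) (auto simp flip: binomial_symmetric)
  finally show ?thesis .
qed

text \<open>The differences of order \<open>0\<close>, \<open>1\<close> and \<open>2\<close> give non-negativity, monotonicity and
midpoint convexity in the exponential scale.\<close>

lemma isCont_exp_scale:
  assumes "0 < x"
  shows "isCont (\<lambda>t. F (x * exp t)) t"
proof (rule midconvex_mono_imp_isCont)
  have scale: "x * exp (t + s) = x * exp t * exp s" for t s
    by (simp add: exp_add)
  show "mono (\<lambda>t. F (x * exp t))"
  proof (rule monoI)
    fix s t :: real assume "s \<le> t"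
    then show "F (x * exp s) \<le> F (x * exp t)"
      using geometric_differences_nonneg[of "x * exp s" "t - s" 1] assms
      by (simp flip: scale)
  qed
  show "0 \<le> F (x * exp t)" for t
    using geometric_differences_nonneg[of "x * exp t" 0 0] assms by simp
  show "2 * F (x * exp (t + h)) \<le> F (x * exp t) + F (x * exp (t + 2 * h))" if "0 \<le> h" for t h
    using geometric_differences_nonneg[of "x * exp t" h 2] assms that
    by (simp add: numeral_2_eq_2 flip: scale)
qed

text \<open>Starting from \<open>x0 = a / e\<close>, the function \<open>s \<mapsto> F (x0 * exp (2 * s))\<close> extends
holomorphically to the unit disc, and \<open>a\<close> corresponds to the interior point \<open>s = 1/2\<close>. Composing
the extension with the principal logarithm gives the function sought.\<close>

lemma locally_holomorphic_pos:
  assumes "0 < a"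
  obtains h r where "0 < r" "h holomorphic_on ball (complex_of_real a) r"
    "\<And>x. \<bar>x - a\<bar> < r \<Longrightarrow> h (complex_of_real x) = complex_of_real (F x)"
proof -
  define x0 where "x0 = a / exp 1"
  have x0: "0 < x0" "x0 < a"
    using assms by (auto simp: x0_def field_simps)
  obtain H where H: "H holomorphic_on ball 0 1"
    "\<And>s. 0 \<le> s \<Longrightarrow> s < 1 \<Longrightarrow> H (complex_of_real s) = complex_of_real (F (x0 * exp (2 * s)))"
  proof (rule nonneg_differences_imp_holomorphic_extension[of "\<lambda>s. F (x0 * exp (2 * s))"])
    have "isCont (\<lambda>s. F (x0 * exp (2 * s))) s" for s
      by (rule isCont_o2[where g = "\<lambda>t. F (x0 * exp t)" and f = "\<lambda>s. 2 * s"])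
         (use isCont_exp_scale[OF x0(1)] in auto)
    then show "continuous_on {0..1} (\<lambda>s. F (x0 * exp (2 * s)))"
      by (simp add: continuous_at_imp_continuous_on)
    show "0 \<le> (\<Sum>j\<le>n. (-1) ^ (n - j) * of_nat (n choose j) * F (x0 * exp (2 * (of_nat j / of_nat N))))"
      for N n
      using geometric_differences_nonneg[of x0 "2 / of_nat N" n] x0
      by (simp add: mult.commute)
  qed blast
  let ?L = "\<lambda>z. Ln (z / of_real x0) / 2"
  have La: "?L (of_real a) = of_real (1 / 2)"
  proof -
    have "complex_of_real a / of_real x0 = of_real (exp 1)"
      using assms by (simp add: x0_def)
    then show ?thesis by (simp add: Ln_of_real)
  qed
  have slit: "z / of_real x0 \<notin> \<real>\<^sub>\<le>\<^sub>0" if "0 < Re z" for z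
    using that x0 by (auto simp: complex_nonpos_Reals_iff Re_divide_of_real zero_less_divide_iff dest!: not_less[THEN iffD2] intro: divide_pos_pos)
  have "isCont ?L (of_real a)"
    using slit[of "of_real a"] assms x0 by (intro continuous_intros) auto
  then obtain d where d0: "0 < d" "\<And>z. dist z (of_real a) < d \<Longrightarrow> dist (?L z) (?L (of_real a)) < 1 / 2"
    unfolding continuous_at_eps_delta by (metis half_gt_zero zero_less_one)
  have d: "?L z \<in> ball 0 1" if "dist z (of_real a) < d" for z
    using d0(2)[OF that] norm_triangle_sub[of "?L z" "1 / 2"]
    unfolding La by (simp add: dist_norm)
  \<comment> \<open>The extension is only known to agree with \<open>F\<close> for \<open>s \<ge> 0\<close>, that is, to the right of \<open>x0\<close>.\<close>
  define r where "r = min d (a - x0)"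
  have r: "0 < r" "r \<le> d" "r \<le> a - x0"
    using d0(1) x0 by (auto simp: r_def)
  have ball: "?L z \<in> ball 0 1" "0 < Re z" if "z \<in> ball (of_real a) r" for z
  proof -
    show "?L z \<in> ball 0 1" by (rule d) (use that r in \<open>simp add: dist_commute\<close>)
    have "\<bar>Re (of_real a - z)\<bar> < r"
      using that abs_Re_le_cmod[of "of_real a - z"] by (simp add: dist_norm)
    then show "0 < Re z" using r x0 by (simp add: abs_less_iff)
  qed
  show thesis
  proof (rule that[of r "\<lambda>z. H (?L z)"])
    show "(\<lambda>z. H (?L z)) holomorphic_on ball (of_real a) r"
    proof (rule holomorphic_on_compose_gen[OF _ H(1), unfolded o_def])
      show "?L holomorphic_on ball (of_real a) r"
        using slit ball x0 by (intro holomorphic_intros) auto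
      show "?L ` ball (of_real a) r \<subseteq> ball 0 1"
        using ball by blast
    qed
    fix x assume x: "\<bar>x - a\<bar> < r"
    then have xp: "x0 \<le> x" "0 < x" using r x0 by (auto simp: abs_less_iff)
    have "Ln (of_real x / of_real x0) = of_real (ln (x / x0))"
      using xp x0 by (simp add: Ln_of_real flip: of_real_divide)
    then have L: "?L (of_real x) = of_real (ln (x / x0) / 2)" by simp
    have "?L (of_real x) \<in> ball 0 1"
      using x by (intro ball) (simp add: dist_norm abs_minus_commute flip: of_real_diff)
    then have "\<bar>ln (x / x0) / 2\<bar> < 1"
      unfolding L by (simp add: norm_of_real del: of_real_divide)
    moreover have "0 \<le> ln (x / x0) / 2" using xp x0 by simp
    ultimately show "H (?L (of_real x)) = of_real (F x)"
      unfolding L using H(2)[of "ln (x / x0) / 2"] xp x0 by simp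
  qed (use r in auto)
qed

lemma higher_deriv_pos:
  assumes "0 < a"
  shows "((deriv ^^ n) F has_real_derivative (deriv ^^ Suc n) F a) (at a)"
proof -
  obtain h r where "0 < r" "h holomorphic_on ball (complex_of_real a) r"
    "\<And>x. \<bar>x - a\<bar> < r \<Longrightarrow> h (complex_of_real x) = complex_of_real (F x)"
    using locally_holomorphic_pos[OF assms] by blast
  then show ?thesis
    using higher_deriv_real_of_holomorphic(2)[of h a r F a n] by simp
qed

text \<open>The remainder is \<open>o(y ^ n)\<close>, since the Lagrange form replaces the derivative at \<open>a\<close>
by the one at an intermediate point, and this derivative is continuous.\<close>

lemma Taylor_remainder_pos:
  assumes "0 < a" "0 < n"
  shows "((\<lambda>y. (F (a + y) - (\<Sum>m\<le>n. (deriv ^^ m) F a / fact m * y ^ m)) / y ^ n) \<longlongrightarrow> 0) (at_right 0)"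
proof (rule tendstoI)
  fix e :: real assume "0 < e"
  let ?D = "\<lambda>m. (deriv ^^ m) F"
  have "isCont (?D n) a"
    using higher_deriv_pos[OF assms(1)] by (rule DERIV_isCont)
  then obtain d where d: "0 < d" "\<And>x. dist x a < d \<Longrightarrow> dist (?D n x) (?D n a) < e"
    using \<open>0 < e\<close> unfolding continuous_at_eps_delta by blast
  have "dist ((F (a + y) - (\<Sum>m\<le>n. ?D m a / fact m * y ^ m)) / y ^ n) 0 < e" if y: "0 < y" "y < d" for y
  proof -
    obtain t where t: "a < t" "t < a + y"
      "F (a + y) = (\<Sum>m<n. ?D m a / fact m * y ^ m) + ?D n t / fact n * y ^ n"
      using Taylor_up[of n ?D F a "a + y" a] higher_deriv_pos assms y by auto
    have "(F (a + y) - (\<Sum>m\<le>n. ?D m a / fact m * y ^ m)) / y ^ n = (?D n t - ?D n a) / fact n"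
      using y by (simp add: t(3) lessThan_Suc_atMost[symmetric] field_simps)
    also have "\<bar>\<dots>\<bar> \<le> \<bar>?D n t - ?D n a\<bar>"
      by (simp add: divide_le_eq mult_le_cancel_left1 fact_ge_1)
    also have "\<dots> < e"
      using d(2)[of t] t y by (simp add: dist_real_def)
    finally show ?thesis by simp
  qed
  then show "\<forall>\<^sub>F y in at_right 0. dist ((F (a + y) - (\<Sum>m\<le>n. ?D m a / fact m * y ^ m)) / y ^ n) 0 < e"
    using d(1) unfolding eventually_at_right_field by (intro exI[of _ d]) auto
qed

text \<open>The numbers \<open>F (a + u ^ k)\<close> behave like \<open>\<Sum>m\<le>n. \<alpha> m * (u ^ m) ^ k\<close>, where \<open>\<alpha> m\<close> is the
\<open>m\<close>-th Taylor coefficient, as if they were the moments of masses \<open>\<alpha> m\<close> at the points \<open>u ^ m\<close>. The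
polynomial \<open>p\<close> with double zeros at \<open>u ^ m\<close> for \<open>m < n\<close> isolates the mass at \<open>u ^ n\<close>, and the extra
factor \<open>y ^ (2 * k)\<close> with \<open>k\<close> tending to infinity removes the influence of the
Taylor remainder.\<close>

lemma higher_deriv_nonneg_pos:
  assumes "0 < a"
  shows "0 \<le> (deriv ^^ n) F a"
proof (cases "n = 0")
  case True
  then show ?thesis
    using geometric_differences_nonneg[of a 0 0] assms by simp
next
  case False
  define u :: real where "u = 1 / 2"
  define p where "p = (\<Prod>m<n. [:- (u ^ m), 1:]\<^sup>2)"
  define \<alpha> where "\<alpha> = (\<lambda>m. (deriv ^^ m) F a / fact m)"
  define R where "R = (\<lambda>y. F (a + y) - (\<Sum>m\<le>n. \<alpha> m * y ^ m))"
  have poly_p: "poly p y = (\<Prod>m<n. (y - u ^ m)\<^sup>2)" for y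
    by (simp add: p_def poly_prod poly_power)
  have p_root: "poly p (u ^ m) = 0" if "m < n" for m
    using that by (auto simp: poly_p)
  have "u ^ n < u ^ m" if "m < n" for m
    using that by (intro power_strict_decreasing) (auto simp: u_def)
  then have p_n: "0 < poly p (u ^ n)"
    unfolding poly_p by (intro prod_pos) fastforce
  have main: "0 \<le> \<alpha> n * poly p (u ^ n) +
      (\<Sum>j\<le>degree p. coeff p j * u ^ (j * n) * (R (u ^ (2 * k + j)) / (u ^ (2 * k + j)) ^ n))" for k
  proof -
    \<comment> \<open>The exponent \<open>2 * k\<close> is even to keep the test polynomial non-negative for negative \<open>y\<close>.\<close>
    have "0 \<le> (\<Sum>j\<le>degree p. coeff p j * F (a + 1 * u ^ (2 * k + j)))"
    proof (rule two_atom_test_nonneg)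
      fix y :: real
      have "(\<Sum>j\<le>degree p. coeff p j * y ^ (2 * k + j)) = (y ^ k)\<^sup>2 * poly p y"
        by (simp add: poly_altdef sum_distrib_left power_add mult_ac flip: power_mult)
      also have "\<dots> \<ge> 0" by (simp add: poly_p prod_nonneg)
      finally show "0 \<le> (\<Sum>j\<le>degree p. coeff p j * y ^ (2 * k + j))" .
    qed (use assms in \<open>auto simp: u_def\<close>)
    also have "\<dots> = (\<Sum>j\<le>degree p. \<Sum>m\<le>n. \<alpha> m * u ^ (2 * k * m) * (coeff p j * (u ^ m) ^ j)) +
        (\<Sum>j\<le>degree p. coeff p j * R (u ^ (2 * k + j)))"
      unfolding sum.distrib[symmetric]
    proof (rule sum.cong[OF refl])
      fix j
      have "(\<Sum>m\<le>n. \<alpha> m * u ^ (2 * k * m) * (coeff p j * (u ^ m) ^ j)) =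
          coeff p j * (\<Sum>m\<le>n. \<alpha> m * (u ^ (2 * k + j)) ^ m)"
        by (simp add: sum_distrib_left power_add power_mult_distrib mult_ac flip: power_mult)
      then show "coeff p j * F (a + 1 * u ^ (2 * k + j)) =
          (\<Sum>m\<le>n. \<alpha> m * u ^ (2 * k * m) * (coeff p j * (u ^ m) ^ j)) + coeff p j * R (u ^ (2 * k + j))"
        by (simp add: R_def algebra_simps)
    qed
    also have "(\<Sum>j\<le>degree p. \<Sum>m\<le>n. \<alpha> m * u ^ (2 * k * m) * (coeff p j * (u ^ m) ^ j)) =
        (\<Sum>m\<le>n. \<alpha> m * u ^ (2 * k * m) * poly p (u ^ m))"
      by (subst sum.swap) (simp add: poly_altdef sum_distrib_left)
    also have "\<dots> = \<alpha> n * u ^ (2 * k * n) * poly p (u ^ n)"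
      by (simp add: p_root flip: lessThan_Suc_atMost)
    finally have "0 \<le> (\<alpha> n * u ^ (2 * k * n) * poly p (u ^ n) +
        (\<Sum>j\<le>degree p. coeff p j * R (u ^ (2 * k + j)))) / u ^ (2 * k * n)"
      by (rule divide_nonneg_pos) (simp add: u_def)
    also have "\<dots> = \<alpha> n * poly p (u ^ n) + (\<Sum>j\<le>degree p. coeff p j * R (u ^ (2 * k + j)) / u ^ (2 * k * n))"
      by (simp add: add_divide_distrib sum_divide_distrib u_def)
    also have "(\<Sum>j\<le>degree p. coeff p j * R (u ^ (2 * k + j)) / u ^ (2 * k * n)) =
       (\<Sum>j\<le>degree p. coeff p j * u ^ (j * n) * (R (u ^ (2 * k + j)) / (u ^ (2 * k + j)) ^ n))"
    proof (rule sum.cong[OF refl])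
      fix j
      have "(u ^ (2 * k + j)) ^ n = u ^ (2 * k * n) * u ^ (j * n)"
        by (simp add: power_add algebra_simps flip: power_mult)
      moreover have "u \<noteq> 0" by (simp add: u_def)
      ultimately show "coeff p j * R (u ^ (2 * k + j)) / u ^ (2 * k * n) =
          coeff p j * u ^ (j * n) * (R (u ^ (2 * k + j)) / (u ^ (2 * k + j)) ^ n)"
        by (simp add: field_simps)
    qed
    finally show ?thesis .
  qed
  have lim_R: "(\<lambda>k. R (u ^ (2 * k + j)) / (u ^ (2 * k + j)) ^ n) \<longlonglongrightarrow> 0" for j
  proof (rule filterlim_compose[where g = "\<lambda>y. R y / y ^ n" and f = "\<lambda>k. u ^ (2 * k + j)"])
    show "((\<lambda>y. R y / y ^ n) \<longlongrightarrow> 0) (at_right 0)"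
      using Taylor_remainder_pos[OF assms] False by (simp add: R_def \<alpha>_def)
    have "(\<lambda>i. u ^ i) \<longlonglongrightarrow> 0"
      by (rule LIMSEQ_power_zero) (simp add: u_def)
    moreover have "filterlim (\<lambda>k. 2 * k + j) sequentially sequentially"
      by (rule filterlim_subseq) (simp add: strict_mono_def)
    ultimately have "(\<lambda>k. u ^ (2 * k + j)) \<longlonglongrightarrow> 0"
      by (rule filterlim_compose)
    then show "filterlim (\<lambda>k. u ^ (2 * k + j)) (at_right 0) sequentially"
      by (rule tendsto_imp_filterlim_at_right) (auto simp: u_def)
  qed
  have "(\<lambda>k. \<alpha> n * poly p (u ^ n) +
      (\<Sum>j\<le>degree p. coeff p j * u ^ (j * n) * (R (u ^ (2 * k + j)) / (u ^ (2 * k + j)) ^ n)))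
      \<longlonglongrightarrow> \<alpha> n * poly p (u ^ n) + (\<Sum>j\<le>degree p. coeff p j * u ^ (j * n) * 0)"
    by (intro tendsto_intros lim_R)
  then have "0 \<le> \<alpha> n * poly p (u ^ n) + (\<Sum>j\<le>degree p. coeff p j * u ^ (j * n) * 0)"
    by (rule LIMSEQ_le_const) (use main in auto)
  then have "0 \<le> \<alpha> n" using p_n by (simp add: zero_le_mult_iff)
  then have "0 \<le> \<alpha> n * fact n" by simp
  then show ?thesis by (simp add: \<alpha>_def)
qed

text \<open>Bernstein's argument: the derivatives increase, so the remainder at \<open>y\<close> is at most
the term of order \<open>n\<close> with the derivative taken at \<open>y\<close>. The same derivative occurs in the expansion
around \<open>y\<close> at the farther point \<open>z\<close>, all of whose terms are non-negative and bounded by \<open>F z\<close>.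
Comparing the two powers yields the geometric factor.\<close>

lemma Taylor_series_pos:
  assumes "0 < a" "a < y"
  shows "(\<lambda>n. (deriv ^^ n) F a / fact n * (y - a) ^ n) sums F y"
proof -
  let ?D = "\<lambda>m. (deriv ^^ m) F"
  note D = higher_deriv_pos and D_nonneg = higher_deriv_nonneg_pos
  have D_mono: "?D n s \<le> ?D n t" if "0 < s" "s \<le> t" for n s t
  proof (rule DERIV_nonneg_imp_nondecreasing[OF that(2)])
    fix x assume "s \<le> x"
    with that(1) have "0 < x" by simp
    then show "\<exists>y. (?D n has_real_derivative y) (at x) \<and> 0 \<le> y"
      using D[of x n] D_nonneg[of x "Suc n"] by blast
  qed
  have Taylor: "\<exists>t. s < t \<and> t < x \<and> F x = (\<Sum>m<n. ?D m s / fact m * (x - s) ^ m) + ?D n t / fact n * (x - s) ^ n"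
    if "0 < s" "s < x" "0 < n" for s x n
    using Taylor_up[of n ?D F s x s] D that by auto
  \<comment> \<open>Any ratio \<open>(z - y) / (y - a)\<close> greater than \<open>1\<close> would do; here it is \<open>2\<close>.\<close>
  define z where "z = y + 2 * (y - a)"
  have z: "y < z" "0 < y" using assms by (auto simp: z_def)
  have bound: "?D n y / fact n * (z - y) ^ n \<le> F z" for n
  proof -
    obtain t where t: "y < t" "F z = (\<Sum>m<Suc n. ?D m y / fact m * (z - y) ^ m) + ?D (Suc n) t / fact (Suc n) * (z - y) ^ Suc n"
      using Taylor[OF z(2,1) zero_less_Suc[of n]] by blast
    have "0 \<le> ?D (Suc n) t / fact (Suc n) * (z - y) ^ Suc n"
      using t(1) z by (intro mult_nonneg_nonneg divide_nonneg_nonneg D_nonneg) auto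
    then have "(\<Sum>m<Suc n. ?D m y / fact m * (z - y) ^ m) \<le> F z"
      unfolding t(2) by simp
    moreover have "0 \<le> (\<Sum>m<n. ?D m y / fact m * (z - y) ^ m)"
      using z by (intro sum_nonneg mult_nonneg_nonneg divide_nonneg_nonneg D_nonneg) auto
    ultimately show ?thesis by simp
  qed
  have rem: "\<bar>F y - (\<Sum>m<n. ?D m a / fact m * (y - a) ^ m)\<bar> \<le> F z * (1 / 2) ^ n" if n: "0 < n" for n
  proof -
    obtain t where t: "a < t" "t < y" "F y = (\<Sum>m<n. ?D m a / fact m * (y - a) ^ m) + ?D n t / fact n * (y - a) ^ n"
      using Taylor[OF assms n] by blast
    have "\<bar>F y - (\<Sum>m<n. ?D m a / fact m * (y - a) ^ m)\<bar> = ?D n t / fact n * (y - a) ^ n"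
      using t(1) assms D_nonneg[of t n] by (simp add: t(3))
    also have "\<dots> \<le> ?D n y / fact n * (y - a) ^ n"
      using t assms D_mono[of t y n] by (intro mult_right_mono divide_right_mono) auto
    also have "\<dots> = (?D n y / fact n * (z - y) ^ n) * (1 / 2) ^ n"
    proof -
      have "(z - y) * (1 / 2) = y - a" by (simp add: z_def field_simps)
      then show ?thesis by (simp only: mult.assoc flip: power_mult_distrib)
    qed
    also have "\<dots> \<le> F z * (1 / 2) ^ n"
      by (intro mult_right_mono bound) auto
    finally show ?thesis .
  qed
  have "(\<lambda>n. F y - (\<Sum>m<n. ?D m a / fact m * (y - a) ^ m)) \<longlonglongrightarrow> 0"
  proof (rule Lim_null_comparison)
    show "\<forall>\<^sub>F n in sequentially. norm (F y - (\<Sum>m<n. ?D m a / fact m * (y - a) ^ m)) \<le> F z * (1 / 2) ^ n"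
      by (rule eventually_mono[OF eventually_gt_at_top[of 0]]) (simp only: real_norm_def rem)
    show "(\<lambda>n. F z * (1 / 2) ^ n) \<longlonglongrightarrow> 0"
      by (intro tendsto_mult_right_zero LIMSEQ_power_zero) auto
  qed
  then have "(\<lambda>n. F y - (F y - (\<Sum>m<n. ?D m a / fact m * (y - a) ^ m))) \<longlonglongrightarrow> F y - 0"
    by (intro tendsto_diff tendsto_const)
  then show ?thesis by (simp add: sums_def)
qed

text \<open>The Taylor series at \<open>a\<close> converges at every point to the right of \<open>a\<close>, so its radius of
convergence is infinite.\<close>

lemma entire_extension_from:
  assumes "0 < a"
  obtains g where "g holomorphic_on UNIV"
    "\<And>x. a < x \<Longrightarrow> g (complex_of_real x) = complex_of_real (F x)"
proof -
  define c where "c = (\<lambda>n. complex_of_real ((deriv ^^ n) F a / fact n))"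
  define g where "g = (\<lambda>w. \<Sum>n. c n * (w - of_real a) ^ n)"
  have sums: "(\<lambda>n. c n * (w - of_real a) ^ n) sums g w" for w
  proof -
    have "summable (\<lambda>n. norm (c n * (w - of_real a) ^ n))"
    proof (rule summable_comparison_test')
      let ?y = "a + norm (w - of_real a) + 1"
      show "summable (\<lambda>n. (deriv ^^ n) F a / fact n * (?y - a) ^ n)"
        by (rule sums_summable[OF Taylor_series_pos[OF assms]]) (simp add: add_nonneg_pos)
      fix n :: nat
      show "norm (norm (c n * (w - of_real a) ^ n)) \<le> (deriv ^^ n) F a / fact n * (?y - a) ^ n"
        using higher_deriv_nonneg_pos[OF assms, of n]
        by (auto simp: c_def norm_mult norm_power norm_divide intro!: divide_right_mono mult_left_mono power_mono)
    qed
    then show ?thesis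
      unfolding g_def by (rule summable_sums[OF summable_norm_cancel])
  qed
  show thesis
  proof (rule that[of g])
    have hol: "g holomorphic_on ball (of_real a) r" for r
      by (rule power_series_holomorphic) (rule sums)
    have "g field_differentiable at w" for w
      by (rule holomorphic_on_imp_differentiable_at[OF hol[of "dist (of_real a) w + 1"] open_ball]) simp
    then show "g holomorphic_on UNIV"
      by (auto simp: holomorphic_on_def field_differentiable_at_within)
    show "g (of_real x) = of_real (F x)" if "a < x" for x
    proof -
      have "(\<lambda>n. complex_of_real ((deriv ^^ n) F a / fact n * (x - a) ^ n)) sums of_real (F x)"
        using Taylor_series_pos[OF assms that] by (simp only: sums_of_real_iff)
      moreover have "(\<lambda>n. complex_of_real ((deriv ^^ n) F a / fact n * (x - a) ^ n)) =
          (\<lambda>n. c n * (of_real x - of_real a) ^ n)"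
        by (simp add: c_def)
      ultimately show ?thesis
        using sums[of "of_real x"] sums_unique2 by metis
    qed
  qed
qed

text \<open>By the identity theorem the entire functions obtained from different base points
coincide, so that the function \<open>g\<close> found for the base point \<open>1\<close> agrees with \<open>F\<close> on the whole positive
half-line. Its derivatives are non-negative there, and the non-negativity passes to the limit
at \<open>0\<close>.\<close>

lemma entire_extension_pos:
  obtains g where "absolutely_monotonic_entire g"
    "\<And>x. 0 < x \<Longrightarrow> g (complex_of_real x) = complex_of_real (F x)"
proof -
  obtain g where g: "g holomorphic_on UNIV" "\<And>x. 1 < x \<Longrightarrow> g (complex_of_real x) = complex_of_real (F x)"
    using entire_extension_from[OF zero_less_one] by blast
  have eq: "g (of_real x) = of_real (F x)" if x: "0 < x" for x
  proof -
    obtain k where k: "k holomorphic_on UNIV" "\<And>y. x / 2 < y \<Longrightarrow> k (complex_of_real y) = complex_of_real (F y)"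
      using entire_extension_from[OF half_gt_zero[OF x]] by blast
    define b where "b = max 1 (x / 2)"
    let ?U = "of_real ` {b<..} :: complex set"
    have "g (of_real x) - k (of_real x) = 0"
    proof (rule analytic_continuation[of "\<lambda>z. g z - k z" UNIV ?U "of_real (b + 1)"])
      have "b + 1 islimpt {b<..}"
        by (intro interior_limit_point) (simp add: interior_open)
      then show "complex_of_real (b + 1) islimpt ?U"
        by (rule islimpt_isCont_image) (auto simp: eventually_at_filter simp del: of_real_add)
    qed (use g k in \<open>auto simp: b_def intro!: holomorphic_intros\<close>)
    then show ?thesis using k(2)[of x] x by simp
  qed
  have "(deriv ^^ n) g 0 / fact n \<in> \<real>\<^sub>\<ge>\<^sub>0" for n
  proof -
    have pos: "(deriv ^^ n) g (of_real x) \<in> \<real>\<^sub>\<ge>\<^sub>0" if "0 < x" for x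
    proof -
      have "(deriv ^^ n) g (of_real x) = of_real ((deriv ^^ n) F x)"
        by (rule higher_deriv_real_of_holomorphic(1)[where a = x and r = x])
           (use g(1) eq that in \<open>auto intro: holomorphic_on_subset\<close>)
      then show ?thesis
        using higher_deriv_nonneg_pos[OF that, of n] by simp
    qed
    have "(deriv ^^ n) g holomorphic_on UNIV"
      by (intro holomorphic_higher_deriv g(1) open_UNIV)
    then have "isCont ((deriv ^^ n) g) 0"
      by (meson holomorphic_on_imp_continuous_on continuous_on_eq_continuous_at open_UNIV UNIV_I)
    moreover have "(\<lambda>m. complex_of_real (1 / of_nat (Suc m))) \<longlonglongrightarrow> 0"
      using tendsto_of_real[OF LIMSEQ_Suc[OF lim_1_over_n], where 'a = complex]
      by (simp only: of_real_0)
    ultimately have lim: "(\<lambda>m. (deriv ^^ n) g (of_real (1 / of_nat (Suc m)))) \<longlonglongrightarrow> (deriv ^^ n) g 0"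
      by (rule isCont_tendsto_compose)
    have mem: "(deriv ^^ n) g (of_real (1 / of_nat (Suc m))) \<in> \<real>\<^sub>\<ge>\<^sub>0" for m
      by (rule pos) simp
    have "(deriv ^^ n) g 0 \<in> \<real>\<^sub>\<ge>\<^sub>0"
      by (rule closed_sequentially[OF closed_nonneg_Reals_complex mem lim])
    moreover have "fact n \<in> (\<real>\<^sub>\<ge>\<^sub>0 :: complex set)"
      using nonneg_Reals_of_real_iff[of "fact n", where 'a = complex] by simp
    ultimately show ?thesis by (rule nonneg_Reals_divide_I)
  qed
  then show thesis
    using that[of g] g(1) eq by (auto simp: absolutely_monotonic_entire_def)
qed

end

section \<open>Extension to the whole real line\<close>

lemma absolutely_monotonic_entire_power_series:
  assumes "absolutely_monotonic_entire f"
  obtains c G where "\<And>n. (0::real) \<le> c n" "\<And>x. (\<lambda>n. c n * x ^ n) sums G x"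
    "\<And>x. f (complex_of_real x) = complex_of_real (G x)"
proof -
  define c where "c = (\<lambda>n. Re ((deriv ^^ n) f 0 / fact n))"
  define G where "G = (\<lambda>x. Re (f (of_real x)))"
  have hol: "f holomorphic_on UNIV" and nonneg: "\<And>n. (deriv ^^ n) f 0 / fact n \<in> \<real>\<^sub>\<ge>\<^sub>0"
    using assms by (auto simp: absolutely_monotonic_entire_def)
  have c: "complex_of_real (c n) = (deriv ^^ n) f 0 / fact n" "0 \<le> c n" for n
  proof -
    obtain q where "(deriv ^^ n) f 0 / fact n = of_real q" "0 \<le> q"
      using nonneg[of n] by (rule nonneg_Reals_cases)
    then show "complex_of_real (c n) = (deriv ^^ n) f 0 / fact n" "0 \<le> c n"
      by (simp_all add: c_def)
  qed
  have sums: "(\<lambda>n. complex_of_real (c n * x ^ n)) sums f (of_real x)" for x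
    using holomorphic_power_series[of f 0 "norm (complex_of_real x) + 1" "of_real x"]
      holomorphic_on_subset[OF hol] by (simp add: c)
  have G: "(\<lambda>n. c n * x ^ n) sums G x" for x
    using sums_Re[OF sums[of x]] by (simp add: G_def)
  then have "f (of_real x) = of_real (G x)" for x
    using sums_unique2[OF sums[of x]] by (simp only: sums_of_real_iff)
  with c(2) G show thesis by (rule that)
qed

text \<open>A transform is determined by its values on the positive half-line: a point \<open>x \<le> 0\<close> is the
first moment of \<open>\<delta>\<^sub>1 + b * \<delta>\<^sub>u\<close> for \<open>u = -1/2\<close> and a suitable \<open>b\<close>, and all sufficiently late moments of
this measure are positive.\<close>

lemma preserver_eq_if_eq_on_pos:
  assumes F: "\<forall>s \<in> moment_sequences {-1..1}. entrywise F s \<in> moment_sequences {-1..1}"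
    and G: "\<forall>s \<in> moment_sequences {-1..1}. entrywise G s \<in> moment_sequences {-1..1}"
    and eq: "\<And>x. 0 < x \<Longrightarrow> F x = G x"
  shows "F x = G x"
proof (cases "0 < x")
  case False
  define b where "b = 2 * (1 - x)"
  let ?s = "\<lambda>k. 1 + b * (- (1 / 2)) ^ k :: real"
  have s: "?s \<in> moment_sequences {-1..1}"
    by (rule two_atom_moment_sequence) (use False in \<open>auto simp: b_def\<close>)
  have "?s \<longlonglongrightarrow> 1 + b * 0"
    by (intro tendsto_intros LIMSEQ_power_zero) auto
  then have "\<forall>\<^sub>F k in sequentially. 0 < ?s k"
    by (rule order_tendstoD) auto
  then obtain K where "\<And>k. K \<le> k \<Longrightarrow> 0 < ?s k"
    unfolding eventually_sequentially by blast
  then have "entrywise F ?s k = entrywise G ?s k" if "K \<le> k" for k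
    using eq that by (simp add: entrywise_def)
  then have "entrywise F ?s 1 = entrywise G ?s 1"
    by (rule moment_sequences_eq_if_eventually_eq[OF F[rule_format, OF s] G[rule_format, OF s] _ zero_less_one])
  moreover have "?s 1 = x" by (simp add: b_def field_simps)
  ultimately show ?thesis by (simp only: entrywise_def)
qed (rule eq)

theorem theorem3p1:
  fixes F :: "real \<Rightarrow> real"
  shows "(\<forall>s \<in> moment_sequences {-1..1}. entrywise F s \<in> moment_sequences {-1..1}) \<longleftrightarrow>
    (\<exists>f. absolutely_monotonic_entire f \<and> (\<forall>x. f (complex_of_real x) = complex_of_real (F x)))"
proof
  assume F: "\<forall>s \<in> moment_sequences {-1..1}. entrywise F s \<in> moment_sequences {-1..1}"
  obtain f where f: "absolutely_monotonic_entire f"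
    "\<And>x. 0 < x \<Longrightarrow> f (complex_of_real x) = complex_of_real (F x)"
    using entire_extension_pos[OF F] by blast
  obtain c G where G: "\<And>n. (0::real) \<le> c n" "\<And>x. (\<lambda>n. c n * x ^ n) sums G x"
    "\<And>x. f (complex_of_real x) = complex_of_real (G x)"
    using absolutely_monotonic_entire_power_series[OF f(1)] by blast
  have "F x = G x" for x
  proof (rule preserver_eq_if_eq_on_pos[OF F])
    show "\<forall>s \<in> moment_sequences {-1..1}. entrywise G s \<in> moment_sequences {-1..1}"
      using nonneg_power_series_preserves_moment_sequences[OF G(1,2)] by blast
    show "F x = G x" if "0 < x" for x
      using f(2)[OF that] G(3)[of x] by simp
  qed
  with f(1) G(3)
  show "\<exists>f. absolutely_monotonic_entire f \<and> (\<forall>x. f (complex_of_real x) = complex_of_real (F x))"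
    by auto
next
  assume "\<exists>f. absolutely_monotonic_entire f \<and> (\<forall>x. f (complex_of_real x) = complex_of_real (F x))"
  then obtain f where f: "absolutely_monotonic_entire f" "\<And>x. f (complex_of_real x) = complex_of_real (F x)"
    by blast
  obtain c G where G: "\<And>n. (0::real) \<le> c n" "\<And>x. (\<lambda>n. c n * x ^ n) sums G x"
    "\<And>x. f (complex_of_real x) = complex_of_real (G x)"
    using absolutely_monotonic_entire_power_series[OF f(1)] by blast
  have "F = G" using f(2) G(3) by auto
  then show "\<forall>s \<in> moment_sequences {-1..1}. entrywise F s \<in> moment_sequences {-1..1}"
    using nonneg_power_series_preserves_moment_sequences[OF G(1,2)] by blast
qed

end
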